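(* Let $\mathcal{Y}=\{0,1\}^n$, let $\mathcal{Z}$ be a set, let $\mathcal{F}$ be a family of probability distributions on $\mathcal{Y}$, let $T$ be a statistical functional on $\mathcal{F}$ (either $\mathcal{Z}$-valued, or set-valued with values subsets of $\mathcal{Z}$), and let $s:\mathcal{Y}\times\mathcal{Z}\to\mathbb{R}$ be a $T$-proper scoring function for $\mathcal{F}$. Let $\mathcal{X}=(\mathcal{X}_\bullet)^n$ for a measurable space $\mathcal{X}_\bullet$, and let $\mathcal{F}_{XY}$ be a family of probability distributions for $(X,Y)$ on $\mathcal{X}\times\mathcal{Y}$. Then the mapping form $\vec s$ is a $\vec T$-proper scoring function for $\mathcal{F}_{XY}$ if for each $P_{XY}\in\mathcal{F}_{XY}$ there exists a family of conditional distributions $\{P_{Y\mid X=x}\}_x$ of $Y$ given $X=x$ which is a subset of $\mathcal{F}$.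
   Context: A scoring function $s:\mathcal{Y}\times\mathcal{Z}\to\mathbb{R}$ is $T$-proper for $\mathcal{F}$ if for all $P\in\mathcal{F}$ and all $u\in\mathcal{Z}$: $\mathbb{E}_P[s(Y,u)]\le\mathbb{E}_P[s(Y,T(P))]$ when $T$ is $\mathcal{Z}$-valued, or $\mathbb{E}_P[s(Y,u)]\le\mathbb{E}_P[s(Y,t)]$ for all $t\in T(P)$ when $T$ is set-valued. The mapping prediction space is $\vec{\mathcal{Z}}=\{f:\mathcal{X}\to\mathcal{Z}\}$. The mapping form of $s$ is $\vec s:(\mathcal{X}\times\mathcal{Y})\times\vec{\mathcal{Z}}\to\mathbb{R}$, $\vec s((x,y),f)=s(y,f(x))$. The mapping functional $\vec T$ on $\mathcal{F}_{XY}$ is given by $\vec T(P_{XY})(x)=T(P_{Y\mid X=x})$, where $P_{Y\mid X=x}$ denotes the conditional distribution of $Y$ given $X=x$ under $P_{XY}$ (taken from the family contained in $\mathcal{F}$). For set-valued $T$, this means that $\vec T(P_{XY})$ is the set of mappings $f\in\vec{\mathcal{Z}}$ with $f(x)\in T(P_{Y\mid X=x})$ for each $x\in\mathcal{X}$. $\vec T$-propriety of $\vec s$ for $\mathcal{F}_{XY}$ is the same notion with outcome $(X,Y)$ and prediction space $\vec{\mathcal{Z}}$: for all $P\in\mathcal{F}_{XY}$ and all $f\in\vec{\mathcal{Z}}$, $\mathbb{E}_P[\vec s((X,Y),f)]\le\mathbb{E}_P[\vec s((X,Y),\vec T(P))]$ (respectively, $\le\mathbb{E}_P[\vec s((X,Y),t)]$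 for all $t\in\vec T(P)$ when $T$ is set-valued). *)

theory Defs
  imports "HOL-Probability.Probability"
begin

text \<open>
  Expectations of real-valued functions are taken in the extended sense: measurable functions
  whose positive or negative part has finite integral have an expectation in \<open>[-\<infinity>, \<infinity>]\<close>.
  A scoring function composed with an arbitrary prediction mapping need not be measurable, and
  its Bochner integral would then be the junk value 0.
\<close>

definition has_expectation :: "'o measure \<Rightarrow> ('o \<Rightarrow> real) \<Rightarrow> bool" where
  "has_expectation P g \<longleftrightarrow> g \<in> borel_measurable P \<and>
     ((\<integral>\<^sup>+w. ennreal (g w) \<partial>P) < \<infinity> \<or> (\<integral>\<^sup>+w. ennreal (- g w) \<partial>P) < \<infinity>)"

definition ext_expectation :: "'o measure \<Rightarrow> ('o \<Rightarrow> real) \<Rightarrow> ereal" where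
  "ext_expectation P g =
     enn2ereal (\<integral>\<^sup>+w. ennreal (g w) \<partial>P) - enn2ereal (\<integral>\<^sup>+w. ennreal (- g w) \<partial>P)"

lemma has_expectation_integrable:
  assumes "integrable P g"
  shows "has_expectation P g"
  using assms by (auto simp: has_expectation_def real_integrable_def top.not_eq_extremum)

lemma ext_expectation_integrable:
  assumes "integrable P g"
  shows "ext_expectation P g = ereal (integral\<^sup>L P g)"
proof -
  let ?p = "\<integral>\<^sup>+w. ennreal (g w) \<partial>P" and ?n = "\<integral>\<^sup>+w. ennreal (- g w) \<partial>P"
  have "?p \<noteq> \<infinity>" "?n \<noteq> \<infinity>"
    using assms by (auto simp: real_integrable_def)
  then obtain a b where "0 \<le> a" "0 \<le> b" "?p = ennreal a" "?n = ennreal b"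
    by (metis ennreal_cases infinity_ennreal_def)
  then show ?thesis
    using assms by (simp add: ext_expectation_def real_lebesgue_integral_def enn2ereal_ennreal)
qed

datatype ('o, 'z) functional =
    Point_Valued "'o measure \<Rightarrow> 'z"
  | Set_Valued "'o measure \<Rightarrow> 'z set"

fun functional_on :: "'o measure set \<Rightarrow> 'z set \<Rightarrow> ('o, 'z) functional \<Rightarrow> bool" where
  "functional_on F Z (Point_Valued T) \<longleftrightarrow> (\<forall>P\<in>F. T P \<in> Z)"
| "functional_on F Z (Set_Valued T) \<longleftrightarrow> (\<forall>P\<in>F. T P \<subseteq> Z)"

text \<open>The comparison of two predictions is only demanded when both expected scores exist.\<close>

definition expected_score_le ::
  "'o measure \<Rightarrow> ('o \<Rightarrow> 'z \<Rightarrow> real) \<Rightarrow> 'z \<Rightarrow> 'z \<Rightarrow> bool" where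
  "expected_score_le P s u t \<longleftrightarrow>
     (has_expectation P (\<lambda>w. s w u) \<and> has_expectation P (\<lambda>w. s w t) \<longrightarrow>
      ext_expectation P (\<lambda>w. s w u) \<le> ext_expectation P (\<lambda>w. s w t))"

fun proper_for ::
  "'z set \<Rightarrow> 'o measure set \<Rightarrow> ('o, 'z) functional \<Rightarrow> ('o \<Rightarrow> 'z \<Rightarrow> real) \<Rightarrow> bool" where
  "proper_for Z F (Point_Valued T) s \<longleftrightarrow>
     (\<forall>P\<in>F. \<forall>u\<in>Z. expected_score_le P s u (T P))"
| "proper_for Z F (Set_Valued T) s \<longleftrightarrow>
     (\<forall>P\<in>F. \<forall>u\<in>Z. \<forall>t\<in>T P. expected_score_le P s u t)"

definition binary_space :: "nat \<Rightarrow> (nat \<Rightarrow> nat) measure" where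
  "binary_space n = count_space ({..<n} \<rightarrow>\<^sub>E {0, 1})"

definition power_space :: "'a measure \<Rightarrow> nat \<Rightarrow> (nat \<Rightarrow> 'a) measure" where
  "power_space A n = Pi\<^sub>M {..<n} (\<lambda>_. A)"

text \<open>Regular conditional distributions of the second component given the first.\<close>

definition conditional_family ::
  "'x measure \<Rightarrow> 'y measure \<Rightarrow> ('x \<times> 'y) measure \<Rightarrow> ('x \<Rightarrow> 'y measure) \<Rightarrow> bool" where
  "conditional_family X Y P \<kappa> \<longleftrightarrow> \<kappa> \<in> X \<rightarrow>\<^sub>M prob_algebra Y \<and>
     (\<forall>A\<in>sets X. \<forall>B\<in>sets Y.
        emeasure P (A \<times> B) = (\<integral>\<^sup>+x\<in>A. emeasure (\<kappa> x) B \<partial>distr P X fst))"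

definition mapping_space :: "'x measure \<Rightarrow> 'z set \<Rightarrow> ('x \<Rightarrow> 'z) set" where
  "mapping_space X Z = space X \<rightarrow>\<^sub>E Z"

definition mapping_form :: "('y \<Rightarrow> 'z \<Rightarrow> real) \<Rightarrow> 'x \<times> 'y \<Rightarrow> ('x \<Rightarrow> 'z) \<Rightarrow> real" where
  "mapping_form s = (\<lambda>(x, y) f. s y (f x))"

text \<open>
  Conditional distributions are unique only up to null sets, so the mapping functional depends
  on a choice \<open>K\<close> of a conditional family for each joint distribution.
\<close>

fun mapping_functional ::
  "'x measure \<Rightarrow> 'z set \<Rightarrow> (('x \<times> 'y) measure \<Rightarrow> 'x \<Rightarrow> 'y measure) \<Rightarrow>
   ('y, 'z) functional \<Rightarrow> ('x \<times> 'y, 'x \<Rightarrow> 'z) functional" where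
  "mapping_functional X Z K (Point_Valued T) =
     Point_Valued (\<lambda>P. \<lambda>x\<in>space X. T (K P x))"
| "mapping_functional X Z K (Set_Valued T) =
     Set_Valued (\<lambda>P. {f \<in> mapping_space X Z. \<forall>x\<in>space X. f x \<in> T (K P x)})"

definition conditional_choice ::
  "'x measure \<Rightarrow> 'y measure \<Rightarrow> 'y measure set \<Rightarrow> ('x \<times> 'y) measure set \<Rightarrow>
   (('x \<times> 'y) measure \<Rightarrow> 'x \<Rightarrow> 'y measure) \<Rightarrow> bool" where
  "conditional_choice X Y F F_XY K \<longleftrightarrow>
     (\<forall>P\<in>F_XY. conditional_family X Y P (K P) \<and> (\<forall>x\<in>space X. K P x \<in> F))"

end

theory Submission
  imports Defs
begin

text \<open>
  Disintegrating \<open>P\<close> into the law of \<open>X\<close> and the kernel \<open>\<kappa>\<close>, propriety applied to each \<open>\<kappa> x\<close>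
  compares the conditional expected scores. Expected scores may be infinite, so the comparison is
  integrated over \<open>x\<close> in the subtraction-free form \<open>a\<^sup>+ + b\<^sup>- \<le> b\<^sup>+ + a\<^sup>-\<close> of
  \<open>a\<^sup>+ - a\<^sup>- \<le> b\<^sup>+ - b\<^sup>-\<close>.
\<close>

text \<open>The pushforward of \<open>\<kappa> x\<close> under \<open>Pair x\<close> is the product
  of the point mass at \<open>x\<close> with \<open>\<kappa> x\<close>. Measurability in
  \<open>x\<close> makes it a kernel that can be bound to the law of \<open>X\<close> to rebuild the
  joint law.\<close>

lemma measurable_kernel_Pair:
  assumes "\<kappa> \<in> X \<rightarrow>\<^sub>M prob_algebra Y"
  shows "(\<lambda>x. distr (\<kappa> x) (X \<Otimes>\<^sub>M Y) (Pair x)) \<in> X \<rightarrow>\<^sub>M subprob_algebra (X \<Otimes>\<^sub>M Y)"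
  using assms by (intro measurable_distr2[where M = Y]) (auto intro: measurable_prob_algebraD)

lemma kernel_sets:
  assumes "\<kappa> \<in> X \<rightarrow>\<^sub>M prob_algebra Y" "x \<in> space X"
  shows "sets (\<kappa> x) = sets Y" "prob_space (\<kappa> x)"
  using measurable_space[OF assms] by (auto simp: space_prob_algebra)

text \<open>\<open>conditional_family\<close> prescribes \<open>P\<close> on measurable rectangles
  only. These form an intersection-stable generator of the product sigma-algebra, and the whole
  space is itself a rectangle of finite measure, so agreement on them determines the
  measure.\<close>

lemma conditional_family_disintegration:
  assumes P: "P \<in> space (prob_algebra (X \<Otimes>\<^sub>M Y))"
    and cond: "conditional_family X Y P \<kappa>"
  shows "P = distr P X fst \<bind> (\<lambda>x. distr (\<kappa> x) (X \<Otimes>\<^sub>M Y) (Pair x))"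
    (is "P = ?M \<bind> ?k")
proof -
  have \<kappa>: "\<kappa> \<in> X \<rightarrow>\<^sub>M prob_algebra Y"
    using cond by (simp add: conditional_family_def)
  have sets_P: "sets P = sets (X \<Otimes>\<^sub>M Y)" and "prob_space P"
    using P by (auto simp: space_prob_algebra)
  interpret P: prob_space P by fact
  have "fst \<in> P \<rightarrow>\<^sub>M X"
    by (simp add: measurable_cong_sets[OF sets_P refl])
  \<comment> \<open>\<open>bind\<close> takes a default value on an empty source space. Since
    \<open>P\<close> has total mass 1, its space contains a point, whose first coordinate lies in
    \<open>space X\<close>.\<close>
  then have nonempty: "space ?M \<noteq> {}"
    using P.not_empty by (auto dest: measurable_space)
  have k: "?k \<in> ?M \<rightarrow>\<^sub>M subprob_algebra (X \<Otimes>\<^sub>M Y)"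
    using measurable_kernel_Pair[OF \<kappa>] by simp
  let ?E = "{A \<times> B | A B. A \<in> sets X \<and> B \<in> sets Y}"
  have bind_sets: "sets (?M \<bind> ?k) = sets (X \<Otimes>\<^sub>M Y)"
    using nonempty by (intro sets_bind) auto
  show ?thesis
  proof (rule measure_eqI_generator_eq[where E = ?E and \<Omega> = "space X \<times> space Y"
        and A = "\<lambda>_. space X \<times> space Y"])
    show "Int_stable ?E"
      by (rule Int_stable_pair_measure_generator)
    show "?E \<subseteq> Pow (space X \<times> space Y)"
      by (auto dest: sets.sets_into_space)
    show "sets P = sigma_sets (space X \<times> space Y) ?E"
      by (simp add: sets_P sets_pair_measure)
    show "sets (?M \<bind> ?k) = sigma_sets (space X \<times> space Y) ?E"
      by (simp add: bind_sets sets_pair_measure)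
    show "range (\<lambda>_::nat. space X \<times> space Y) \<subseteq> ?E"
      by auto
    show "emeasure P (space X \<times> space Y) \<noteq> \<infinity>" for i :: nat
      by simp
    fix E assume "E \<in> ?E"
    then obtain A B where E: "E = A \<times> B" and A: "A \<in> sets X" and B: "B \<in> sets Y"
      by auto
    have "emeasure (?M \<bind> ?k) E = (\<integral>\<^sup>+x. emeasure (?k x) E \<partial>?M)"
      using nonempty k A B E by (intro emeasure_bind[where N = "X \<Otimes>\<^sub>M Y"]) auto
    also have "\<dots> = (\<integral>\<^sup>+x. emeasure (\<kappa> x) B * indicator A x \<partial>?M)"
    proof (rule nn_integral_cong)
      fix x assume "x \<in> space ?M"
      then have x: "x \<in> space X" by simp
      note kx = kernel_sets[OF \<kappa> x]
      have "Pair x \<in> \<kappa> x \<rightarrow>\<^sub>M X \<Otimes>\<^sub>M Y"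
        using x kx(1) by (simp cong: measurable_cong_sets)
      then have "emeasure (?k x) E = emeasure (\<kappa> x) (Pair x -` (A \<times> B) \<inter> space (\<kappa> x))"
        using A B E by (simp add: emeasure_distr)
      \<comment> \<open>The section of a rectangle at \<open>x\<close> is \<open>B\<close> or empty,
        which produces the factor \<open>indicator A x\<close> of the set integral in
        \<open>conditional_family\<close>.\<close>
      also have "Pair x -` (A \<times> B) \<inter> space (\<kappa> x) = (if x \<in> A then B else {})"
        using B sets.sets_into_space[of B Y] sets_eq_imp_space_eq[OF kx(1)] by auto
      finally show "emeasure (?k x) E = emeasure (\<kappa> x) B * indicator A x"
        by simp
    qed
    also have "\<dots> = emeasure P E"
      using cond A B E by (simp add: conditional_family_def)
    finally show "emeasure P E = emeasure (?M \<bind> ?k) E" ..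
  qed auto
qed

text \<open>Integration against a bind is iterated integration. Stated for
  \<open>ennreal\<close>-valued functions, it applies to positive and negative parts even where one
  of them has an infinite integral.\<close>

lemma nn_integral_disintegration:
  assumes P: "P \<in> space (prob_algebra (X \<Otimes>\<^sub>M Y))"
    and cond: "conditional_family X Y P \<kappa>"
    and h: "h \<in> borel_measurable (X \<Otimes>\<^sub>M Y)"
  shows "(\<integral>\<^sup>+w. h w \<partial>P) = (\<integral>\<^sup>+x. \<integral>\<^sup>+y. h (x, y) \<partial>\<kappa> x \<partial>distr P X fst)"
proof -
  have \<kappa>: "\<kappa> \<in> X \<rightarrow>\<^sub>M prob_algebra Y"
    using cond by (simp add: conditional_family_def)
  have "(\<integral>\<^sup>+w. h w \<partial>P) =
      (\<integral>\<^sup>+x. \<integral>\<^sup>+w. h w \<partial>distr (\<kappa> x) (X \<Otimes>\<^sub>M Y) (Pair x) \<partial>distr P X fst)"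
    using measurable_kernel_Pair[OF \<kappa>]
    by (subst conditional_family_disintegration[OF P cond], subst nn_integral_bind[OF h]) auto
  also have "\<dots> = (\<integral>\<^sup>+x. \<integral>\<^sup>+y. h (x, y) \<partial>\<kappa> x \<partial>distr P X fst)"
  proof (rule nn_integral_cong)
    fix x assume "x \<in> space (distr P X fst)"
    then have x: "x \<in> space X" by simp
    have "Pair x \<in> \<kappa> x \<rightarrow>\<^sub>M X \<Otimes>\<^sub>M Y"
      using x kernel_sets(1)[OF \<kappa> x] by (simp cong: measurable_cong_sets)
    then show "(\<integral>\<^sup>+w. h w \<partial>distr (\<kappa> x) (X \<Otimes>\<^sub>M Y) (Pair x)) = (\<integral>\<^sup>+y. h (x, y) \<partial>\<kappa> x)"
      using h by (simp add: nn_integral_distr)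
  qed
  finally show ?thesis .
qed

lemma borel_measurable_nn_integral_kernel:
  assumes \<kappa>: "\<kappa> \<in> X \<rightarrow>\<^sub>M prob_algebra Y"
    and h: "h \<in> borel_measurable (X \<Otimes>\<^sub>M Y)"
  shows "(\<lambda>x. \<integral>\<^sup>+y. h (x, y) \<partial>\<kappa> x) \<in> borel_measurable X"
  using h by (intro nn_integral_measurable_subprob_algebra2[where N = Y] measurable_prob_algebraD \<kappa>) auto

text \<open>On a finite discrete space every function is measurable and bounded by the sum of its
  absolute values. Hence conditional expected scores always exist and are finite.\<close>

lemma integrable_finite_count_space:
  fixes g :: "'b \<Rightarrow> real"
  assumes "finite B" "sets Q = sets (count_space B)" "prob_space Q"
  shows "integrable Q g"
proof -
  interpret prob_space Q by fact
  have space: "space Q = B"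
    using sets_eq_imp_space_eq[OF assms(2)] by simp
  show ?thesis
  proof (rule integrable_const_bound[where B = "\<Sum>y\<in>B. \<bar>g y\<bar>"])
    show "AE y in Q. norm (g y) \<le> (\<Sum>y\<in>B. \<bar>g y\<bar>)"
      using assms(1) by (intro AE_I2) (auto simp: space intro: member_le_sum)
    show "g \<in> borel_measurable Q"
      by (simp add: measurable_cong_sets[OF assms(2) refl])
  qed
qed

text \<open>The finiteness assumptions exclude \<open>\<infinity> - \<infinity>\<close> on both
  sides. If \<open>b\<close> is infinite, the left side is \<open>-\<infinity>\<close>; if
  \<open>c\<close> is infinite, the right side is \<open>\<infinity>\<close>; otherwise all four
  values are finite and the claim is real arithmetic.\<close>

lemma ereal_diff_le_of_add_le:
  assumes "a + d \<le> c + b" "a < \<infinity> \<or> b < \<infinity>" "c < \<infinity> \<or> d < \<infinity>"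
  shows "enn2ereal a - enn2ereal b \<le> enn2ereal c - enn2ereal d"
  using assms
  by (cases a; cases b; cases c; cases d)
    (auto simp: enn2ereal_ennreal top_ennreal.rep_eq top_unique simp flip: ennreal_plus)

text \<open>Integrability makes all four part integrals finite, so the subtracted terms can be moved
  across the inequality.\<close>

lemma integral_le_imp_nn_integral_parts_le:
  fixes f g :: "'b \<Rightarrow> real"
  assumes "integrable Q f" "integrable Q g" "integral\<^sup>L Q f \<le> integral\<^sup>L Q g"
  shows "(\<integral>\<^sup>+y. ennreal (f y) \<partial>Q) + (\<integral>\<^sup>+y. ennreal (- g y) \<partial>Q) \<le>
    (\<integral>\<^sup>+y. ennreal (g y) \<partial>Q) + (\<integral>\<^sup>+y. ennreal (- f y) \<partial>Q)"
    (is "?a + ?d \<le> ?c + ?b")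
proof -
  have "?a \<noteq> \<infinity>" "?b \<noteq> \<infinity>" "?c \<noteq> \<infinity>" "?d \<noteq> \<infinity>"
    using assms(1,2) by (auto simp: real_integrable_def)
  moreover have "enn2real ?a - enn2real ?b \<le> enn2real ?c - enn2real ?d"
    using assms by (simp add: real_lebesgue_integral_def)
  ultimately show ?thesis
    by (cases ?a; cases ?b; cases ?c; cases ?d) (auto simp flip: ennreal_plus)
qed

lemma expected_score_le_mapping_form:
  fixes u t :: "'x \<Rightarrow> 'z" and s :: "'y \<Rightarrow> 'z \<Rightarrow> real"
  assumes B: "finite B"
    and P: "P \<in> space (prob_algebra (X \<Otimes>\<^sub>M count_space B))"
    and cond: "conditional_family X (count_space B) P \<kappa>"
    and le: "\<And>x. x \<in> space X \<Longrightarrow> expected_score_le (\<kappa> x) s (u x) (t x)"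
  shows "expected_score_le P (mapping_form s) u t"
  unfolding expected_score_le_def
proof (intro impI, elim conjE)
  let ?S = "X \<Otimes>\<^sub>M count_space B" and ?M = "distr P X fst"
  define g where "g f w = mapping_form s w f" for f :: "'x \<Rightarrow> 'z" and w
  assume "has_expectation P (\<lambda>w. mapping_form s w u)" "has_expectation P (\<lambda>w. mapping_form s w t)"
  then have u: "has_expectation P (g u)" and t: "has_expectation P (g t)"
    by (simp_all add: g_def[abs_def])
  have \<kappa>: "\<kappa> \<in> X \<rightarrow>\<^sub>M prob_algebra (count_space B)"
    using cond by (simp add: conditional_family_def)
  have sets_P: "sets P = sets ?S"
    using P by (simp add: space_prob_algebra)
  \<comment> \<open>\<open>u\<close> and \<open>t\<close> are arbitrary mappings. Joint
    measurability of their scores comes from the existence of both expectations, the premise in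
    \<open>expected_score_le\<close>.\<close>
  have meas [measurable]: "g u \<in> borel_measurable ?S" "g t \<in> borel_measurable ?S"
    using u t unfolding has_expectation_def measurable_cong_sets[OF sets_P refl] by auto
  have kernel_meas: "(\<lambda>x. \<integral>\<^sup>+y. ennreal (h (x, y)) \<partial>\<kappa> x) \<in> borel_measurable ?M"
    if [measurable]: "h \<in> borel_measurable ?S" for h
    using borel_measurable_nn_integral_kernel[OF \<kappa>, of "\<lambda>w. ennreal (h w)"] by simp
  have pointwise:
    "(\<integral>\<^sup>+y. ennreal (g u (x, y)) \<partial>\<kappa> x) + (\<integral>\<^sup>+y. ennreal (- g t (x, y)) \<partial>\<kappa> x) \<le>
     (\<integral>\<^sup>+y. ennreal (g t (x, y)) \<partial>\<kappa> x) + (\<integral>\<^sup>+y. ennreal (- g u (x, y)) \<partial>\<kappa> x)"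
    if x: "x \<in> space X" for x
  proof (rule integral_le_imp_nn_integral_parts_le)
    have int: "integrable (\<kappa> x) h" for h :: "_ \<Rightarrow> real"
      using integrable_finite_count_space[OF B kernel_sets[OF \<kappa> x]] .
    show "integrable (\<kappa> x) (\<lambda>y. g u (x, y))" "integrable (\<kappa> x) (\<lambda>y. g t (x, y))"
      by (rule int)+
    \<comment> \<open>The guard in \<open>expected_score_le\<close> holds at every \<open>x\<close>
      by integrability, so \<open>le\<close> yields a comparison of ordinary integrals.\<close>
    show "(\<integral>y. g u (x, y) \<partial>\<kappa> x) \<le> (\<integral>y. g t (x, y) \<partial>\<kappa> x)"
      using le[OF x] has_expectation_integrable[OF int] ext_expectation_integrable[OF int]
      by (simp add: expected_score_le_def g_def mapping_form_def)
  qed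
  note disint = nn_integral_disintegration[OF P cond]
  \<comment> \<open>Each side of the pointwise inequality is gathered under a single integral over
    the law of \<open>X\<close>, so that monotonicity applies without any subtraction.\<close>
  have add: "(\<integral>\<^sup>+w. ennreal (h w) \<partial>P) + (\<integral>\<^sup>+w. ennreal (k w) \<partial>P) =
      (\<integral>\<^sup>+x. (\<integral>\<^sup>+y. ennreal (h (x, y)) \<partial>\<kappa> x) + (\<integral>\<^sup>+y. ennreal (k (x, y)) \<partial>\<kappa> x) \<partial>?M)"
    if [measurable]: "h \<in> borel_measurable ?S" "k \<in> borel_measurable ?S" for h k
    using disint[of "\<lambda>w. ennreal (h w)"] disint[of "\<lambda>w. ennreal (k w)"]
      nn_integral_add[OF kernel_meas[of h] kernel_meas[of k]] by simp
  have "(\<integral>\<^sup>+w. ennreal (g u w) \<partial>P) + (\<integral>\<^sup>+w. ennreal (- g t w) \<partial>P) \<le>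
      (\<integral>\<^sup>+w. ennreal (g t w) \<partial>P) + (\<integral>\<^sup>+w. ennreal (- g u w) \<partial>P)"
    using add[of "g u" "\<lambda>w. - g t w"] add[of "g t" "\<lambda>w. - g u w"]
    by (auto intro!: nn_integral_mono pointwise)
  \<comment> \<open>\<open>has_expectation\<close> for \<open>u\<close> and for \<open>t\<close>
    supplies the two finiteness conditions needed to return to differences.\<close>
  then have "ext_expectation P (g u) \<le> ext_expectation P (g t)"
    using u t unfolding ext_expectation_def has_expectation_def
    by (intro ereal_diff_le_of_add_le) auto
  then show "ext_expectation P (\<lambda>w. mapping_form s w u) \<le> ext_expectation P (\<lambda>w. mapping_form s w t)"
    by (simp add: g_def[abs_def])
qed

lemma conditional_choice_exists:
  assumes "\<forall>P\<in>F_XY. \<exists>\<kappa>. conditional_family X Y P \<kappa> \<and> (\<forall>x\<in>space X. \<kappa> x \<in> F)"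
  shows "\<exists>K. conditional_choice X Y F F_XY K"
  using bchoice[OF assms] unfolding conditional_choice_def .

text \<open>At each \<open>x\<close>, the measure \<open>K P x\<close> lies in \<open>F\<close> and
  the competing prediction \<open>u x\<close> lies in \<open>Z\<close>. Propriety of
  \<open>s\<close> therefore compares \<open>u x\<close> with the value of the mapping functional at
  \<open>x\<close>, or with any selection from it in the set-valued case.\<close>

lemma proper_for_mapping_form:
  assumes B: "finite B"
    and proper: "proper_for Z F T s"
    and F_XY: "F_XY \<subseteq> space (prob_algebra (X \<Otimes>\<^sub>M count_space B))"
    and K: "conditional_choice X (count_space B) F F_XY K"
  shows "proper_for (mapping_space X Z) F_XY (mapping_functional X Z K T) (mapping_form s)"
proof -
  have step: "expected_score_le P (mapping_form s) u t"
    if "P \<in> F_XY" "\<And>x. x \<in> space X \<Longrightarrow> expected_score_le (K P x) s (u x) (t x)" for P u t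
    using that F_XY K
    by (intro expected_score_le_mapping_form[OF B, where \<kappa> = "K P"]) (auto simp: conditional_choice_def)
  have in_F: "K P x \<in> F" if "P \<in> F_XY" "x \<in> space X" for P x
    using that K by (simp add: conditional_choice_def)
  have in_Z: "u x \<in> Z" if "u \<in> mapping_space X Z" "x \<in> space X" for u x
    using that by (auto simp: mapping_space_def)
  show ?thesis
    using proper by (cases T) (auto intro!: step simp: in_F in_Z)
qed

text \<open>The mapping functional depends on the chosen versions of the conditional distributions.
  Propriety is claimed for every admissible choice \<open>K\<close>, and the existence conjunct
  shows that this claim is not vacuous.\<close>

theorem theorem7:
  fixes n :: nat
    and X0 :: "'a measure"
    and X :: "(nat \<Rightarrow> 'a) measure"
    and Y :: "(nat \<Rightarrow> nat) measure"
    and Z :: "'z set"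
    and F :: "(nat \<Rightarrow> nat) measure set"
    and T :: "(nat \<Rightarrow> nat, 'z) functional"
    and s :: "(nat \<Rightarrow> nat) \<Rightarrow> 'z \<Rightarrow> real"
    and F_XY :: "((nat \<Rightarrow> 'a) \<times> (nat \<Rightarrow> nat)) measure set"
  defines "Y \<equiv> binary_space n"
    and "X \<equiv> power_space X0 n"
  assumes "F \<subseteq> space (prob_algebra Y)"
    and "functional_on F Z T"
    and "proper_for Z F T s"
    and "F_XY \<subseteq> space (prob_algebra (X \<Otimes>\<^sub>M Y))"
    and "\<forall>P\<in>F_XY. \<exists>\<kappa>. conditional_family X Y P \<kappa> \<and> (\<forall>x\<in>space X. \<kappa> x \<in> F)"
  shows "(\<exists>K. conditional_choice X Y F F_XY K) \<and>
    (\<forall>K. conditional_choice X Y F F_XY K \<longrightarrow>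
       proper_for (mapping_space X Z) F_XY (mapping_functional X Z K T) (mapping_form s))"
proof (intro conjI allI impI)
  show "\<exists>K. conditional_choice X Y F F_XY K"
    using assms(7) by (rule conditional_choice_exists)
next
  fix K assume K: "conditional_choice X Y F F_XY K"
  \<comment> \<open>Finiteness of the binary cube is what guarantees finite conditional expected
    scores.\<close>
  have fin: "finite ({..<n} \<rightarrow>\<^sub>E {0::nat, 1})"
    by (intro finite_PiE) auto
  show "proper_for (mapping_space X Z) F_XY (mapping_functional X Z K T) (mapping_form s)"
    using proper_for_mapping_form[OF fin assms(5)] assms(6) K
    unfolding Y_def binary_space_def by blast
qed

end
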